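(* Let $F$ be a baseline distribution function. For $\alpha\ge 0$, $\beta,\theta>0$, let $G_{\alpha,\beta,\theta}$ be the distribution function whose odds function is $$\Lambda_{G_{\alpha,\beta,\theta}}(x)=\beta\left((\alpha+\Lambda_F(x))^\theta-\alpha^\theta\right),$$ and for $\alpha_1\ge 0$, $\beta_1,\theta_1>0$ let $$K_{\alpha_1,\beta_1,\theta_1}(x)=1-\frac{1}{\left(\frac{x}{\beta_1}+\alpha_1^{\theta_1}\right)^{1/\theta_1}+1-\alpha_1},\qquad x\ge 0.$$ If $F$ has increasing odds rate and $\theta,\theta_1\ge 1$, then $G_{\alpha,\beta,\theta}\leq_c K_{\alpha_1,\beta_1,\theta_1}$. On the other hand, if $F$ has decreasing odds rate and $\theta,\theta_1\le 1$, then $K_{\alpha_1,\beta_1,\theta_1}\leq_c G_{\alpha,\beta,\theta}$.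
   Context: The baseline $F$ is a distribution function on $\mathbb{R}$ with density $f$. The odds function of a distribution function $H$ is $\Lambda_H=H/(1-H)=\frac1{1-H}-1$ (equal to $+\infty$ where $H=1$), and its odds rate is $\lambda_H=\Lambda_H'$, i.e. density divided by $(1-H)^2$. $F$ has increasing (decreasing) odds rate if $\lambda_F$ is weakly increasing (decreasing) on the support interval of $F$; equivalently $\Lambda_F$ is convex (concave) there. $F_1\leq_c F_2$ (convex transform order) means that $F_2^{-1}\circ F_1$ is convex on the support interval of $F_1$. The support of $F$ is taken to be an interval. *)

theory Defs
  imports "HOL-Probability.Probability"
begin

definition distribution_function :: "(real \<Rightarrow> real) \<Rightarrow> bool" where
  "distribution_function H \<longleftrightarrow> (\<exists>M. real_distribution M \<and> H = cdf M)"

definition has_density :: "(real \<Rightarrow> real) \<Rightarrow> (real \<Rightarrow> real) \<Rightarrow> bool" where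
  "has_density H h \<longleftrightarrow> h \<in> borel_measurable borel \<and> (\<forall>x. 0 \<le> h x) \<and>
     H = cdf (density lborel (\<lambda>x. ennreal (h x)))"

text \<open>
  The topological support of the distribution with distribution function \<open>H\<close>: the (closed) set of
  points all of whose neighbourhoods have positive probability.
\<close>

definition df_support :: "(real \<Rightarrow> real) \<Rightarrow> real set" where
  "df_support H = {x. \<forall>\<epsilon>>0. H (x - \<epsilon>) < H (x + \<epsilon>)}"

definition odds :: "(real \<Rightarrow> real) \<Rightarrow> real \<Rightarrow> ereal" where
  "odds H x = (if H x = 1 then \<infinity> else ereal (H x / (1 - H x)))"

definition odds_rate :: "(real \<Rightarrow> real) \<Rightarrow> (real \<Rightarrow> real) \<Rightarrow> real \<Rightarrow> real" where
  "odds_rate H h x = h x / (1 - H x)\<^sup>2"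

text \<open>
  Monotonicity is required in the interior of the support interval only. At a finite end point the
  value of the density is immaterial (a decreasing odds rate may be unbounded at the left end
  point), and at a finite right end point \<open>H = 1\<close>, so that the odds rate is not defined there.
\<close>

definition increasing_odds_rate :: "(real \<Rightarrow> real) \<Rightarrow> (real \<Rightarrow> real) \<Rightarrow> bool" where
  "increasing_odds_rate H h \<longleftrightarrow> mono_on (interior (df_support H)) (odds_rate H h)"

definition decreasing_odds_rate :: "(real \<Rightarrow> real) \<Rightarrow> (real \<Rightarrow> real) \<Rightarrow> bool" where
  "decreasing_odds_rate H h \<longleftrightarrow> antimono_on (interior (df_support H)) (odds_rate H h)"

text \<open>
  The generalised inverse \<open>H\<^sup>-\<^sup>1(p) = inf {x. H x \<ge> p}\<close>. For \<open>0 < p \<le> 1\<close> the restriction of \<open>x\<close> to the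
  support does not change the infimum; for \<open>p = 0\<close> it makes \<open>H\<^sup>-\<^sup>1(0)\<close> the left end point of the
  support rather than \<open>-\<infinity>\<close>. The value \<open>H\<^sup>-\<^sup>1(1)\<close> is \<open>\<infinity>\<close> if the support is unbounded above.
\<close>

definition df_inverse :: "(real \<Rightarrow> real) \<Rightarrow> real \<Rightarrow> ereal" where
  "df_inverse H p = Inf (ereal ` {x \<in> df_support H. p \<le> H x})"

text \<open>
  The counterpart of \<^const>\<open>convex_on\<close> for extended real values; \<open>t = 0\<close> and \<open>t = 1\<close> are
  trivial and left out to avoid products of \<open>0\<close> and \<open>\<plusminus>\<infinity>\<close>.
\<close>

definition ereal_convex_on :: "real set \<Rightarrow> (real \<Rightarrow> ereal) \<Rightarrow> bool" where
  "ereal_convex_on S \<phi> \<longleftrightarrow> convex S \<and>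
     (\<forall>x\<in>S. \<forall>y\<in>S. \<forall>t. 0 < t \<and> t < 1 \<longrightarrow>
        \<phi> ((1 - t) * x + t * y) \<le> ereal (1 - t) * \<phi> x + ereal t * \<phi> y)"

definition convex_transform_le :: "(real \<Rightarrow> real) \<Rightarrow> (real \<Rightarrow> real) \<Rightarrow> bool"
    (infix "\<le>\<^sub>c" 50) where
  "H\<^sub>1 \<le>\<^sub>c H\<^sub>2 \<longleftrightarrow> ereal_convex_on (df_support H\<^sub>1) (\<lambda>x. df_inverse H\<^sub>2 (H\<^sub>1 x))"

text \<open>Real powers extended by \<open>\<infinity>\<^sup>p = \<infinity>\<close>; used only for bases in \<open>[0, \<infinity>]\<close> and \<open>p > 0\<close>.\<close>

definition epowr :: "ereal \<Rightarrow> real \<Rightarrow> ereal" where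
  "epowr y p = (if y = \<infinity> then \<infinity> else ereal (real_of_ereal y powr p))"

text \<open>\<open>K\<close> is given by a formula on \<open>[0, \<infinity>)\<close>, where it starts at \<open>0\<close>; it vanishes on the negative
  half-line.\<close>

definition K_df :: "real \<Rightarrow> real \<Rightarrow> real \<Rightarrow> real \<Rightarrow> real" where
  "K_df \<alpha> \<beta> \<theta> x =
     (if x < 0 then 0 else 1 - 1 / ((x / \<beta> + \<alpha> powr \<theta>) powr (1 / \<theta>) + 1 - \<alpha>))"

end

theory Submission
  imports Defs
begin

text \<open>
  Write \<open>L = F / (1 - F)\<close>, \<open>g(w) = \<beta> ((\<alpha> + w)\<^sup>\<theta> - \<alpha>\<^sup>\<theta>)\<close> and \<open>k\<close> for the analogue of \<open>g\<close> with the
  parameters of \<open>K\<close>. The odds of \<open>G\<close> are \<open>g \<circ> L\<close> and the odds of \<open>K\<close> are \<open>k\<^sup>-\<^sup>1\<close>, so that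
  \<open>K\<^sup>-\<^sup>1 \<circ> G = k \<circ> g \<circ> L\<close>, a composition of increasing convex functions if the odds rate increases
  and the exponents are at least 1. In the decreasing case \<open>G(s) \<ge> K(x)\<close> means
  \<open>g(L(s)) \<ge> k\<^sup>-\<^sup>1(x)\<close> with \<open>g \<circ> L\<close> concave and \<open>k\<^sup>-\<^sup>1\<close> convex; the set of such pairs \<open>(x, s)\<close> is
  convex, hence so is the lower envelope \<open>x \<mapsto> G\<^sup>-\<^sup>1(K(x))\<close>.

  A decreasing odds rate forces the support to be bounded below and \<open>F < 1\<close> on it, which excludes
  the value \<open>-\<infinity>\<close> of \<open>G\<^sup>-\<^sup>1 \<circ> K\<close> and the value \<open>\<infinity>\<close> of the odds of \<open>F\<close>.
\<close>

section \<open>Powers\<close>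

text \<open>At positive arguments this is \<open>powr_convex\<close>. If one argument is 0, its
  power vanishes, and what remains is \<open>s powr p \<le> s\<close> for \<open>s\<close> strictly
  between 0 and 1.\<close>

lemma convex_on_powr_nonneg:
  assumes "1 \<le> (p::real)"
  shows "convex_on {0..} (\<lambda>x::real. x powr p)"
proof -
  have half: "((1 - t) * x + t * y) powr p \<le> (1 - t) * x powr p + t * y powr p"
    if "0 < t" "t < 1" "0 \<le> x" "0 \<le> y" for t x y :: real
  proof (cases "x = 0 \<or> y = 0")
    case True
    have "s powr p \<le> s" if "0 < s" "s < 1" for s :: real
      using that assms powr_mono'[of 1 p s] by simp
    then have "(1 - t) powr p * x powr p \<le> (1 - t) * x powr p"
      "t powr p * y powr p \<le> t * y powr p"
      using that by (auto intro!: mult_right_mono)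
    with True that show ?thesis
      by (auto simp: powr_mult)
  next
    case False
    with that convex_onD[OF powr_convex[OF assms], of t x y] show ?thesis
      by (simp add: less_le)
  qed
  show ?thesis
    by (rule convex_onI) (auto intro: half)
qed

lemma convex_comb_powr:
  fixes p t x y :: real
  assumes "1 \<le> p" "0 \<le> t" "t \<le> 1" "0 \<le> x" "0 \<le> y"
  shows "((1 - t) * x + t * y) powr p \<le> (1 - t) * x powr p + t * y powr p"
  using convex_onD[OF convex_on_powr_nonneg[OF assms(1)] assms(2,3), of x y] assms by simp

text \<open>Convexity of the power \<open>1 / p\<close> at the points \<open>x powr p\<close> and
  \<open>y powr p\<close>; both sides are then raised to the power \<open>p\<close>.\<close>

lemma concave_comb_powr:
  fixes p t x y :: real
  assumes "0 < p" "p \<le> 1" "0 \<le> t" "t \<le> 1" "0 \<le> x" "0 \<le> y"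
  shows "(1 - t) * x powr p + t * y powr p \<le> ((1 - t) * x + t * y) powr p"
proof -
  let ?s = "(1 - t) * x powr p + t * y powr p"
  have s0: "0 \<le> ?s" using assms by simp
  have "?s powr (1 / p) \<le> (1 - t) * (x powr p) powr (1 / p) + t * (y powr p) powr (1 / p)"
    using assms by (intro convex_comb_powr) auto
  then have "?s powr (1 / p) \<le> (1 - t) * x + t * y"
    using assms by (simp add: powr_powr)
  then have "(?s powr (1 / p)) powr p \<le> ((1 - t) * x + t * y) powr p"
    using assms by (intro powr_mono2) auto
  then show ?thesis
    using s0 assms by (simp add: powr_powr)
qed

text \<open>Lets \<open>c\<close> tend to 1 from the right; this removes the error factor from the
  increment bounds for the odds.\<close>

lemma le_if_le_mult_gt_one:
  fixes A B :: real
  assumes "\<And>c. 1 < c \<Longrightarrow> A \<le> c * B"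
  shows "A \<le> B"
proof (rule tendsto_lowerbound)
  show "((\<lambda>c. c * B) \<longlongrightarrow> B) (at_right 1)"
    by (auto intro!: tendsto_eq_intros)
  show "\<forall>\<^sub>F c in at_right 1. A \<le> c * B"
    using assms by (auto simp: eventually_at_filter)
qed simp

lemma real_odds_le_iff:
  fixes p q :: real
  assumes "p < 1" "q < 1"
  shows "p / (1 - p) \<le> q / (1 - q) \<longleftrightarrow> p \<le> q"
  using assms by (simp add: field_simps)

text \<open>Average the two tangent inequalities with weights \<open>1 - t\<close> and
  \<open>t\<close>: the slope terms cancel because \<open>z\<close> is the average of
  \<open>x\<close> and \<open>y\<close>.\<close>

lemma convex_comb_of_tangent:
  fixes L :: "real \<Rightarrow> real"
  assumes "L z + m * (x - z) \<le> L x" "L z + m * (y - z) \<le> L y" "z = (1 - t) * x + t * y"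
    "0 \<le> t" "t \<le> 1"
  shows "L z \<le> (1 - t) * L x + t * L y"
proof -
  have "(1 - t) * (L z + m * (x - z)) + t * (L z + m * (y - z)) \<le> (1 - t) * L x + t * L y"
    using assms by (intro add_mono mult_left_mono) auto
  moreover have "(1 - t) * (L z + m * (x - z)) + t * (L z + m * (y - z)) = L z"
    by (simp add: assms(3) algebra_simps)
  ultimately show ?thesis by simp
qed

section \<open>The odds of a distribution with a density\<close>

locale df_with_density =
  fixes F f :: "real \<Rightarrow> real"
  assumes df: "distribution_function F"
    and density: "has_density F f"
    and interval_support: "is_interval (df_support F)"
begin

abbreviation L :: "real \<Rightarrow> real" where
  "L x \<equiv> F x / (1 - F x)"

abbreviation N :: "real measure" where
  "N \<equiv> density lborel (\<lambda>x. ennreal (f x))"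

section \<open>Basic properties of the distribution function and its density\<close>

lemma f_meas [measurable]: "f \<in> borel_measurable borel"
  and f_nonneg: "0 \<le> f x"
  and F_N: "F = cdf N"
  using density by (auto simp: has_density_def)

lemma F_mono: "x \<le> y \<Longrightarrow> F x \<le> F y"
  and F_nonneg: "0 \<le> F x"
  and F_le_1: "F x \<le> 1"
  and F_at_top: "(F \<longlongrightarrow> 1) at_top"
  and F_at_bot: "(F \<longlongrightarrow> 0) at_bot"
proof -
  obtain M where M: "real_distribution M" and FM: "F = cdf M"
    using df by (auto simp: distribution_function_def)
  interpret real_distribution M by fact
  show "x \<le> y \<Longrightarrow> F x \<le> F y" "0 \<le> F x" "F x \<le> 1" "(F \<longlongrightarrow> 1) at_top" "(F \<longlongrightarrow> 0) at_bot"
    by (simp_all add: FM cdf_nondecreasing cdf_nonneg cdf_bounded_prob cdf_lim_at_top_prob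
        cdf_lim_at_bot)
qed

text \<open>As \<^const>\<open>measure\<close> is \<open>0\<close> on sets of infinite measure, the finiteness of the measure with
  density \<open>f\<close> is not automatic: it comes from \<open>F\<close> tending to \<open>1\<close>.\<close>

lemma emeasure_N_atMost: "emeasure N {..y} = ennreal (F y)"
proof -
  have "emeasure N {..y} \<noteq> \<infinity>"
  proof
    assume inf: "emeasure N {..y} = \<infinity>"
    have "F z = 0" if "y \<le> z" for z
    proof -
      have "emeasure N {..y} \<le> emeasure N {..z}"
        using that by (intro emeasure_mono) auto
      with inf show ?thesis
        by (simp add: F_N cdf_def measure_def top_unique)
    qed
    then have "(F \<longlongrightarrow> 0) at_top"
      by (intro tendsto_eventually) (auto simp: eventually_at_top_linorder)
    with F_at_top show False
      using tendsto_unique[of at_top F 0 1] by simp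
  qed
  then show ?thesis
    by (simp add: F_N cdf_def emeasure_eq_ennreal_measure)
qed

text \<open>The total mass is the limit of the masses of \<open>{..real n}\<close>, that is, the
  limit of \<open>F\<close> at infinity.\<close>

lemma real_distribution_N: "real_distribution N"
proof -
  have "(\<lambda>n. emeasure N {..real n}) \<longlonglongrightarrow> emeasure N (\<Union>n. {..real n})"
    by (intro Lim_emeasure_incseq) (auto simp: incseq_def)
  moreover have "(\<Union>n. {..real n}) = UNIV"
    using real_arch_simple by auto
  moreover have "(\<lambda>n. emeasure N {..real n}) \<longlonglongrightarrow> ennreal 1"
    unfolding emeasure_N_atMost
    by (intro tendsto_ennrealI filterlim_compose[OF F_at_top] filterlim_real_sequentially)
  ultimately have "emeasure N UNIV = ennreal 1"
    by (metis LIMSEQ_unique)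
  then show ?thesis
    by (intro real_distribution.intro prob_spaceI real_distribution_axioms.intro) auto
qed

lemma isCont_F: "isCont F x"
proof -
  interpret N: real_distribution N by (rule real_distribution_N)
  have "emeasure N {x} = (\<integral>\<^sup>+ t. ennreal (f t) * indicator {x} t \<partial>lborel)"
    by (simp add: emeasure_density)
  also have "\<dots> = (\<integral>\<^sup>+ (t::real). 0 \<partial>lborel)"
    using AE_lborel_singleton[of x]
    by (intro nn_integral_cong_AE, elim eventually_mono) (auto split: split_indicator)
  finally show ?thesis
    by (simp add: F_N N.isCont_cdf measure_def)
qed

text \<open>Deleting the null point \<open>y\<close> leaves an open interval. Bounds on the density
  are then required strictly between the end points only, which matters since the odds rate is
  monotone only in the interior of the support.\<close>

lemma F_increment:
  assumes "x \<le> y"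
  shows "ennreal (F y - F x) = (\<integral>\<^sup>+ t. ennreal (f t) * indicator {x<..<y} t \<partial>lborel)"
proof -
  interpret N: real_distribution N by (rule real_distribution_N)
  have "ennreal (F y - F x) = emeasure N {x<..y}"
    using assms by (simp add: F_N N.emeasure_Ioc)
  also have "\<dots> = (\<integral>\<^sup>+ t. ennreal (f t) * indicator {x<..y} t \<partial>lborel)"
    by (simp add: emeasure_density)
  also have "\<dots> = (\<integral>\<^sup>+ t. ennreal (f t) * indicator {x<..<y} t \<partial>lborel)"
    using AE_lborel_singleton[of y] by (intro nn_integral_cong_AE) (auto split: split_indicator)
  finally show ?thesis .
qed

lemma F_increment_le:
  assumes "x \<le> y" "0 \<le> u" "\<And>t. x < t \<Longrightarrow> t < y \<Longrightarrow> f t \<le> u"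
  shows "F y - F x \<le> u * (y - x)"
proof -
  have "ennreal (F y - F x) \<le> (\<integral>\<^sup>+ t. ennreal u * indicator {x<..<y} t \<partial>lborel)"
    unfolding F_increment[OF assms(1)]
    using assms(3) by (intro nn_integral_mono) (auto split: split_indicator intro: ennreal_leI)
  also have "\<dots> = ennreal (u * (y - x))"
    using assms by (simp add: nn_integral_cmult ennreal_mult)
  finally show ?thesis
    using assms by (subst (asm) ennreal_le_iff) auto
qed

lemma F_increment_ge:
  assumes "x \<le> y" "0 \<le> l" "\<And>t. x < t \<Longrightarrow> t < y \<Longrightarrow> l \<le> f t"
  shows "l * (y - x) \<le> F y - F x"
proof -
  have "ennreal (l * (y - x)) = (\<integral>\<^sup>+ t. ennreal l * indicator {x<..<y} t \<partial>lborel)"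
    using assms by (simp add: nn_integral_cmult ennreal_mult)
  also have "\<dots> \<le> ennreal (F y - F x)"
    unfolding F_increment[OF assms(1)]
    using assms(3) by (intro nn_integral_mono) (auto split: split_indicator intro: ennreal_leI)
  finally show ?thesis
    using assms F_mono[of x y] by (subst (asm) ennreal_le_iff) auto
qed

section \<open>From bounds on the odds rate to bounds on increments of the odds\<close>

lemma f_eq: "F t < 1 \<Longrightarrow> f t = odds_rate F f t * (1 - F t)\<^sup>2"
  by (simp add: odds_rate_def)

lemma odds_rate_nonneg: "0 \<le> odds_rate F f t"
  by (simp add: odds_rate_def f_nonneg)

lemma survival_ratio_near_1:
  assumes "F t < 1" "1 < c"
  shows "\<exists>d>0. \<forall>x y. x \<le> t \<and> t \<le> y \<and> y - x < d \<longrightarrow> 1 - F x \<le> c * (1 - F y)"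
proof -
  \<comment> \<open>Chosen with \<open>(1 + \<eta>) / (1 - \<eta>) = c\<close>: it suffices that
    \<open>1 - F x\<close> and \<open>1 - F y\<close> differ from \<open>1 - F t\<close> by a
    relative error of at most \<eta>.\<close>
  define \<eta> where "\<eta> = (c - 1) / (c + 1)"
  have c: "1 + \<eta> = c * (1 - \<eta>)"
    using assms by (simp add: \<eta>_def field_simps)
  have "0 < \<eta> * (1 - F t)"
    using assms by (simp add: \<eta>_def)
  then obtain d where d: "d > 0" "\<And>s. \<bar>s - t\<bar> < d \<Longrightarrow> \<bar>F s - F t\<bar> < \<eta> * (1 - F t)"
    using isCont_F[of t] unfolding continuous_at_eps_delta dist_real_def by blast
  show ?thesis
  proof (intro exI[of _ d] conjI allI impI d(1))
    fix x y assume xy: "x \<le> t \<and> t \<le> y \<and> y - x < d"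
    then have x: "1 - F x \<le> (1 + \<eta>) * (1 - F t)" and y: "(1 - \<eta>) * (1 - F t) \<le> 1 - F y"
      using d(2)[of x] d(2)[of y] by (auto simp: algebra_simps)
    have "1 - F x \<le> c * ((1 - \<eta>) * (1 - F t))"
      using x unfolding c by (simp only: mult.assoc)
    also have "\<dots> \<le> c * (1 - F y)"
      using y assms by (intro mult_left_mono) auto
    finally show "1 - F x \<le> c * (1 - F y)" .
  qed
qed

lemma L_diff: "F x < 1 \<Longrightarrow> F y < 1 \<Longrightarrow> L y - L x = (F y - F x) / ((1 - F x) * (1 - F y))"
  by (simp add: field_simps)

lemma L_nonneg: "0 \<le> L x"
  by (simp add: F_nonneg F_le_1)

text \<open>
  Integrating \<open>f = odds_rate \<cdot> (1 - F)\<^sup>2\<close> gives the next two bounds up to the factor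
  \<open>(1 - F x) / (1 - F y)\<close>. By continuity of \<open>F\<close> this factor is at most \<open>c\<close> on short intervals, for
  any \<open>c > 1\<close>; the bounds with \<open>c\<close> are additive in the interval, so a bisection argument makes
  them global.
\<close>

lemma L_increment_le:
  assumes "a \<le> b" "F b < 1" "0 \<le> u" "\<And>t. a < t \<Longrightarrow> t < b \<Longrightarrow> odds_rate F f t \<le> u"
  shows "L b - L a \<le> u * (b - a)"
proof (rule le_if_le_mult_gt_one)
  fix c :: real assume c: "1 < c"
  have "a \<le> a \<and> b \<le> b \<longrightarrow> L b - L a \<le> c * (u * (b - a))"
    using \<open>a \<le> b\<close>
  proof (cases rule: Bolzano[where a = a and b = b and P = "\<lambda>x y. a \<le> x \<and> y \<le> b \<longrightarrow> L y - L x \<le> c * (u * (y - x))"])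
    case (trans x y z)
    then show ?case by (auto simp: algebra_simps)
  next
    case (local t)
    then have "F t < 1" using F_mono[of t b] assms by simp
    from survival_ratio_near_1[OF this c] obtain d where d: "d > 0"
      "\<And>x y. x \<le> t \<Longrightarrow> t \<le> y \<Longrightarrow> y - x < d \<Longrightarrow> 1 - F x \<le> c * (1 - F y)"
      by blast
    show ?case
    proof (intro exI[of _ d] conjI allI impI d(1))
      fix x y assume xy: "x \<le> t \<and> t \<le> y \<and> y - x < d" "a \<le> x \<and> y \<le> b"
      have F1: "F y < 1" "F x < 1"
        using F_mono[of x b] F_mono[of y b] xy assms by auto
      \<comment> \<open>On the interval \<open>1 - F\<close> is largest at the left end
        \<open>x\<close>, so \<open>u * (1 - F x)\<^sup>2\<close> dominates the density
        there.\<close>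
      have "F y - F x \<le> (u * (1 - F x)\<^sup>2) * (y - x)"
      proof (rule F_increment_le)
        fix s assume s: "x < s" "s < y"
        then have "F s < 1" "F x \<le> F s" using F_mono[of s y] F_mono[of x s] F1 by auto
        then show "f s \<le> u * (1 - F x)\<^sup>2"
          using s xy assms unfolding f_eq[OF \<open>F s < 1\<close>]
          by (intro mult_mono power_mono) auto
      qed (use xy assms in auto)
      then have "L y - L x \<le> (u * (1 - F x)\<^sup>2) * (y - x) / ((1 - F x) * (1 - F y))"
        unfolding L_diff[OF F1(2,1)] using F1 by (intro divide_right_mono) auto
      also have "\<dots> = (1 - F x) / (1 - F y) * (u * (y - x))"
        using F1 by (simp add: power2_eq_square)
      also have "\<dots> \<le> c * (u * (y - x))"
        using d(2)[of x y] xy F1 assms by (intro mult_right_mono) (auto simp: pos_divide_le_eq)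
      finally show "L y - L x \<le> c * (u * (y - x))" .
    qed
  qed
  then show "L b - L a \<le> c * (u * (b - a))" by simp
qed

lemma L_increment_ge:
  assumes "a \<le> b" "F b < 1" "0 \<le> l" "\<And>t. a < t \<Longrightarrow> t < b \<Longrightarrow> l \<le> odds_rate F f t"
  shows "l * (b - a) \<le> L b - L a"
proof (rule le_if_le_mult_gt_one)
  fix c :: real assume c: "1 < c"
  have "a \<le> a \<and> b \<le> b \<longrightarrow> l * (b - a) \<le> c * (L b - L a)"
    using \<open>a \<le> b\<close>
  proof (cases rule: Bolzano[where a = a and b = b and P = "\<lambda>x y. a \<le> x \<and> y \<le> b \<longrightarrow> l * (y - x) \<le> c * (L y - L x)"])
    case (trans x y z)
    then show ?case by (auto simp: right_diff_distrib)
  next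
    case (local t)
    then have "F t < 1" using F_mono[of t b] assms by simp
    from survival_ratio_near_1[OF this c] obtain d where d: "d > 0"
      "\<And>x y. x \<le> t \<Longrightarrow> t \<le> y \<Longrightarrow> y - x < d \<Longrightarrow> 1 - F x \<le> c * (1 - F y)"
      by blast
    show ?case
    proof (intro exI[of _ d] conjI allI impI d(1))
      fix x y assume xy: "x \<le> t \<and> t \<le> y \<and> y - x < d" "a \<le> x \<and> y \<le> b"
      have F1: "F y < 1" "F x < 1"
        using F_mono[of x b] F_mono[of y b] xy assms by auto
      \<comment> \<open>Dually, \<open>1 - F\<close> is smallest at the right end
        \<open>y\<close>.\<close>
      have "(l * (1 - F y)\<^sup>2) * (y - x) \<le> F y - F x"
      proof (rule F_increment_ge)
        fix s assume s: "x < s" "s < y"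
        then have "F s < 1" "F s \<le> F y" using F_mono[of s y] F1 by auto
        then show "l * (1 - F y)\<^sup>2 \<le> f s"
          using s xy assms F1 unfolding f_eq[OF \<open>F s < 1\<close>]
          by (intro mult_mono power_mono) (auto simp: odds_rate_nonneg)
      qed (use xy assms in auto)
      then have "(l * (1 - F y)\<^sup>2) * (y - x) / ((1 - F x) * (1 - F y)) \<le> L y - L x"
        unfolding L_diff[OF F1(2,1)] using F1 by (intro divide_right_mono) auto
      moreover have "(l * (1 - F y)\<^sup>2) * (y - x) / ((1 - F x) * (1 - F y))
          = (1 - F y) / (1 - F x) * (l * (y - x))"
        using F1 by (simp add: power2_eq_square)
      \<comment> \<open>The survival ratio is at least \<open>1 / c\<close>, so its product with
        \<open>c\<close> is at least 1.\<close>
      moreover have "1 * (l * (y - x)) \<le> (c * ((1 - F y) / (1 - F x))) * (l * (y - x))"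
        using d(2)[of x y] xy F1 assms
        by (intro mult_right_mono) (auto simp: pos_le_divide_eq)
      ultimately show "l * (y - x) \<le> c * (L y - L x)"
        using c mult_left_mono[of "(1 - F y) / (1 - F x) * (l * (y - x))" "L y - L x" c]
        by (simp add: mult.assoc)
    qed
  qed
  then show "l * (b - a) \<le> c * (L b - L a)" by simp
qed

section \<open>Support interval, tangents and convexity of the odds\<close>

lemma F_lt_1: "b \<in> df_support F \<Longrightarrow> x < b \<Longrightarrow> F x < 1"
  \<comment> \<open>The radius \<open>b - x\<close> in the definition of the support gives
    \<open>F x < F (b + (b - x)) \<le> 1\<close>.\<close>
  using F_le_1[of "b + (b - x)"] unfolding df_support_def
  by (auto dest!: spec[of _ "b - x"])

lemma F_lt_1_interior:
  assumes "z \<in> interior (df_support F)"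
  shows "F z < 1"
proof -
  obtain e where e: "e > 0" "ball z e \<subseteq> df_support F"
    using assms by (auto simp: mem_interior)
  then have "z + e / 2 \<in> df_support F" by (auto simp: dist_real_def)
  then show ?thesis by (rule F_lt_1) (use e in simp)
qed

lemma Ioo_subset_interior:
  assumes "a \<in> df_support F" "b \<in> df_support F"
  shows "{a<..<b} \<subseteq> interior (df_support F)"
proof (rule interior_maximal)
  show "{a<..<b} \<subseteq> df_support F"
    using mem_is_interval_1_I[OF interval_support assms] by auto
qed simp

text \<open>Tangents are taken at interior points. Proper convex combinations are such points even
  if \<open>x\<close> or \<open>y\<close> is an end point of the support.\<close>

lemma convex_comb_in_interior:
  assumes "x \<in> df_support F" "y \<in> df_support F" "x \<noteq> y" "0 < t" "t < 1"
  shows "(1 - t) * x + t * y \<in> interior (df_support F)"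
proof -
  have "(1 - t) * x + t * y \<in> {min x y<..<max x y}"
  proof (cases "x < y")
    case True
    then have "t * x < t * y" "(1 - t) * x < (1 - t) * y" using assms by auto
    with True show ?thesis by (auto simp: algebra_simps)
  next
    case False
    then have "y < x" using assms by auto
    then have "t * y < t * x" "(1 - t) * y < (1 - t) * x" using assms by auto
    with \<open>y < x\<close> show ?thesis by (auto simp: algebra_simps)
  qed
  moreover have "{min x y<..<max x y} \<subseteq> interior (df_support F)"
    using assms by (intro Ioo_subset_interior) (auto simp: min_def max_def)
  ultimately show ?thesis by blast
qed

text \<open>To the right of \<open>z\<close> the rate is at least its value at \<open>z\<close>, to
  the left at most that value; the increment bounds turn this into the tangent inequality. Only the
  open interval between \<open>z\<close> and \<open>w\<close> is used, so \<open>w\<close> may be an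
  end point.\<close>

lemma L_ge_tangent:
  assumes "increasing_odds_rate F f" "z \<in> interior (df_support F)" "w \<in> df_support F" "F w < 1"
  shows "L z + odds_rate F f z * (w - z) \<le> L w"
proof -
  have z: "z \<in> df_support F" using assms interior_subset by blast
  note mono = mono_onD[OF assms(1)[unfolded increasing_odds_rate_def]]
  show ?thesis
  proof (cases "z \<le> w")
    case True
    have "odds_rate F f z * (w - z) \<le> L w - L z"
      using True assms z Ioo_subset_interior[of z w]
      by (intro L_increment_ge mono) (auto simp: odds_rate_nonneg)
    then show ?thesis by simp
  next
    case False
    have "L z - L w \<le> odds_rate F f z * (z - w)"
      using False assms z Ioo_subset_interior[of w z] F_lt_1_interior
      by (intro L_increment_le mono) (auto simp: odds_rate_nonneg)
    then show ?thesis by (simp add: algebra_simps)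
  qed
qed

lemma L_le_tangent:
  assumes "decreasing_odds_rate F f" "z \<in> interior (df_support F)" "w \<in> df_support F" "F w < 1"
  shows "L w \<le> L z + odds_rate F f z * (w - z)"
proof -
  have z: "z \<in> df_support F" using assms interior_subset by blast
  note mono = monotone_onD[OF assms(1)[unfolded decreasing_odds_rate_def]]
  show ?thesis
  proof (cases "z \<le> w")
    case True
    have "L w - L z \<le> odds_rate F f z * (w - z)"
      using True assms z Ioo_subset_interior[of z w]
      by (intro L_increment_le mono) (auto simp: odds_rate_nonneg)
    then show ?thesis by simp
  next
    case False
    have "odds_rate F f z * (z - w) \<le> L z - L w"
      using False assms z Ioo_subset_interior[of w z] F_lt_1_interior
      by (intro L_increment_ge mono) (auto simp: odds_rate_nonneg)
    then show ?thesis by (simp add: algebra_simps)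
  qed
qed

lemma L_convex:
  assumes "increasing_odds_rate F f" "x \<in> df_support F" "y \<in> df_support F" "F x < 1" "F y < 1"
    "0 < t" "t < 1"
  shows "L ((1 - t) * x + t * y) \<le> (1 - t) * L x + t * L y"
\<comment> \<open>If \<open>x = y\<close>, the common point may be an end point of the support,
  where no tangent is at hand.\<close>
proof (cases "x = y")
  case False
  then have "(1 - t) * x + t * y \<in> interior (df_support F)"
    using assms convex_comb_in_interior by auto
  with assms show ?thesis
    by (intro convex_comb_of_tangent[where L = L, OF L_ge_tangent L_ge_tangent]) auto
qed (simp only: distrib_right[symmetric], simp)

lemma L_concave:
  assumes "decreasing_odds_rate F f" "x \<in> df_support F" "y \<in> df_support F" "F x < 1" "F y < 1"
    "0 < t" "t < 1"
  shows "(1 - t) * L x + t * L y \<le> L ((1 - t) * x + t * y)"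
proof (cases "x = y")
  case False
  let ?z = "(1 - t) * x + t * y"
  have z: "?z \<in> interior (df_support F)"
    using assms False convex_comb_in_interior by auto
  \<comment> \<open>Tangents lie above \<open>L\<close> here, so the averaging is applied to
    \<open>- L\<close> with negated slope.\<close>
  have "- L ?z \<le> (1 - t) * - L x + t * - L y"
    using L_le_tangent[OF assms(1) z assms(2,4)] L_le_tangent[OF assms(1) z assms(3,5)] assms
    by (intro convex_comb_of_tangent[where L = "\<lambda>x. - L x" and m = "- odds_rate F f ?z"]) auto
  then show ?thesis by (simp add: algebra_simps)
qed (simp only: distrib_right[symmetric], simp)

section \<open>Consequences of a decreasing odds rate for the support\<close>

lemma df_support_meets:
  assumes "F a < F b"
  shows "\<exists>x\<in>df_support F. a \<le> x \<and> x \<le> b"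
proof (rule ccontr)
  assume no: "\<not> ?thesis"
  have "a \<le> b" using assms F_mono[of b a] by linarith
  \<comment> \<open>Near a point outside the support \<open>F\<close> is constant; bisection makes
    it constant on the whole interval.\<close>
  then have "F a = F b"
  proof (cases rule: Bolzano[where a = a and b = b and P = "\<lambda>x y. F x = F y"])
    case (local t)
    with no have "t \<notin> df_support F" by auto
    then obtain e where e: "e > 0" "F (t + e) \<le> F (t - e)"
      by (auto simp: df_support_def not_less)
    show ?case
    proof (intro exI[of _ e] conjI allI impI e(1))
      fix x y assume "x \<le> t \<and> t \<le> y \<and> y - x < e"
      then show "F x = F y"
        using F_mono[of "t - e" x] F_mono[of x y] F_mono[of y "t + e"] e by auto
    qed
  qed simp
  with assms show False by simp
qed

text \<open>The tangent at an interior point bounds the odds up to \<open>b\<close>, whereas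
  \<open>F b = 1\<close> and continuity would make them unbounded near \<open>b\<close>.\<close>

lemma decreasing_F_lt_1:
  assumes "decreasing_odds_rate F f" "b \<in> df_support F"
  shows "F b < 1"
proof (rule ccontr)
  assume "\<not> F b < 1"
  then have Fb: "F b = 1" using F_le_1[of b] by simp
  have small: "\<exists>c'\<le>c. F c' < 1 / 2" for c
  proof -
    have "\<forall>\<^sub>F x in at_bot. F x < 1 / 2 \<and> x \<le> c"
      using order_tendstoD(2)[OF F_at_bot, of "1 / 2"] eventually_le_at_bot[of c]
      by (intro eventually_conj) auto
    from eventually_happens[OF this] show ?thesis by auto
  qed
  \<comment> \<open>Produces a support point \<open>a < b\<close>: the value
    \<open>F c = 1 / 2\<close> separates \<open>c\<close> from \<open>b\<close>, and
    \<open>F\<close> rises between \<open>c1\<close> and \<open>c\<close>.\<close>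
  obtain c0 where "c0 \<le> b" "F c0 < 1 / 2" using small by blast
  then obtain c where c: "c \<le> b" "F c = 1 / 2"
    using IVT'[of F c0 "1 / 2" b] Fb isCont_F by (auto intro: continuous_at_imp_continuous_on)
  obtain c1 where "c1 \<le> c" "F c1 < F c" using small[of c] c by auto
  from df_support_meets[OF this(2)] obtain a where a: "a \<in> df_support F" "a \<le> c" by auto
  have "c \<noteq> b" using c Fb by auto
  then have ab: "a < b" using a c by simp
  define z where "z = (a + b) / 2"
  have z: "z \<in> interior (df_support F)" "z < b"
    using Ioo_subset_interior[OF a(1) assms(2)] ab by (auto simp: z_def)
  \<comment> \<open>The height over \<open>b\<close> of the tangent at \<open>z\<close>.\<close>
  define C where "C = L z + odds_rate F f z * (b - z)"
  \<comment> \<open>This is \<open>L w \<le> C\<close> with the denominator cleared, a form that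
    passes to the limit at \<open>b\<close>, where it reads \<open>1 \<le> 0\<close>.\<close>
  have "F w - C * (1 - F w) \<le> 0" if "z < w" "w < b" for w
  proof -
    have "w \<in> interior (df_support F)"
      using that z a ab Ioo_subset_interior[OF a(1) assms(2)] by (auto simp: z_def)
    then have w: "w \<in> df_support F" "F w < 1"
      using interior_subset F_lt_1_interior by blast+
    have "L w \<le> L z + odds_rate F f z * (w - z)"
      using w assms z by (intro L_le_tangent)
    also have "\<dots> \<le> C"
      unfolding C_def using that by (intro add_left_mono mult_left_mono) (auto simp: odds_rate_nonneg)
    finally show ?thesis using w by (simp add: pos_divide_le_eq)
  qed
  then have "\<forall>\<^sub>F w in at_left b. F w - C * (1 - F w) \<le> 0"
    using eventually_at_left_real[OF z(2)] by (auto elim: eventually_mono)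
  moreover have "((\<lambda>w. F w - C * (1 - F w)) \<longlongrightarrow> F b - C * (1 - F b)) (at_left b)"
    using isCont_F[of b] unfolding isCont_def
    by (intro tendsto_intros) (auto intro: tendsto_within_subset)
  ultimately have "F b - C * (1 - F b) \<le> 0"
    by (intro tendsto_upperbound) auto
  with Fb show False by simp
qed

text \<open>Nonnegative odds cannot stay below a line of positive slope on a left half-line. An
  unbounded support would thus force the rate to vanish and \<open>F\<close> to be constant around
  support points.\<close>

lemma decreasing_support_bdd_below:
  assumes "decreasing_odds_rate F f"
  shows "\<exists>m. \<forall>s\<in>df_support F. m \<le> s"
proof (rule ccontr)
  assume "\<not> ?thesis"
  then have unb: "\<exists>s\<in>df_support F. s < m" for m by (meson not_le)
  then obtain b where b: "b \<in> df_support F" by blast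
  have inter: "x \<in> interior (df_support F)" if "x < b" for x
  proof -
    obtain s where "s \<in> df_support F" "s < x" using unb by blast
    with Ioo_subset_interior[of s b] b that show ?thesis by auto
  qed
  then have supp: "x \<in> df_support F" if "x < b" for x
    using that interior_subset by blast
  have rate: "odds_rate F f x \<le> 0" if x: "x < b" for x
  proof (rule ccontr)
    assume "\<not> ?thesis"
    then have pos: "odds_rate F f x > 0" by simp
    \<comment> \<open>The point where the tangent at \<open>x\<close> takes the value -1.\<close>
    define w where "w = x - (L x + 1) / odds_rate F f x"
    have "0 < (L x + 1) / odds_rate F f x"
      using pos L_nonneg[of x] by (intro divide_pos_pos) auto
    then have w: "w < x" by (simp add: w_def)
    have "L w \<le> L x + odds_rate F f x * (w - x)"
      using w x by (intro L_le_tangent assms inter supp F_lt_1[OF b]) auto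
    also have "\<dots> = -1" using pos by (simp add: w_def)
    finally show False using L_nonneg[of w] by simp
  qed
  \<comment> \<open>\<open>F\<close> does not grow from \<open>b - 3\<close> to
    \<open>b - 1\<close>, although the midpoint \<open>b - 2\<close> is a support point.\<close>
  have F1: "F (b - 1) < 1" "F (b - 3) < 1" using F_lt_1[OF b] by auto
  have "L (b - 1) - L (b - 3) \<le> 0 * ((b - 1) - (b - 3))"
    using F1 rate by (intro L_increment_le) auto
  then have "F (b - 1) \<le> F (b - 3)"
    using real_odds_le_iff[OF F1] by simp
  moreover have "F (b - 2 - 1) < F (b - 2 + 1)"
    using supp[of "b - 2"] unfolding df_support_def by (auto dest!: spec[of _ 1])
  ultimately show False by simp
qed

end

section \<open>The transformation of the odds and its inverse\<close>

text \<open>The map g of the overview. With the parameters of K it is k, which takes the odds of p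
  to the p-quantile of K.\<close>

definition odds_power :: "real \<Rightarrow> real \<Rightarrow> real \<Rightarrow> real \<Rightarrow> real" where
  "odds_power \<alpha> \<beta> \<theta> w = \<beta> * ((\<alpha> + w) powr \<theta> - \<alpha> powr \<theta>)"

text \<open>On the nonnegative half-line this is the inverse of \<open>odds_power\<close>, and there
  it is the odds function of \<open>K_df\<close>.\<close>

definition odds_root :: "real \<Rightarrow> real \<Rightarrow> real \<Rightarrow> real \<Rightarrow> real" where
  "odds_root \<alpha> \<beta> \<theta> x = (x / \<beta> + \<alpha> powr \<theta>) powr (1 / \<theta>) - \<alpha>"

context
  fixes \<alpha> \<beta> \<theta> :: real
  assumes \<alpha>: "0 \<le> \<alpha>" and \<beta>: "0 < \<beta>" and \<theta>: "0 < \<theta>"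
begin

lemma odds_power_mono:
  "0 \<le> v \<Longrightarrow> v \<le> w \<Longrightarrow> odds_power \<alpha> \<beta> \<theta> v \<le> odds_power \<alpha> \<beta> \<theta> w"
  using \<alpha> \<beta> \<theta> by (simp add: odds_power_def powr_mono2)

lemma odds_power_strict_mono:
  "0 \<le> v \<Longrightarrow> v < w \<Longrightarrow> odds_power \<alpha> \<beta> \<theta> v < odds_power \<alpha> \<beta> \<theta> w"
  using \<alpha> \<beta> \<theta> by (simp add: odds_power_def powr_less_mono2)

lemma odds_power_le_iff:
  "0 \<le> v \<Longrightarrow> 0 \<le> w \<Longrightarrow> odds_power \<alpha> \<beta> \<theta> v \<le> odds_power \<alpha> \<beta> \<theta> w \<longleftrightarrow> v \<le> w"
  using odds_power_mono[of v w] odds_power_strict_mono[of w v] by linarith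

lemma odds_power_nonneg: "0 \<le> w \<Longrightarrow> 0 \<le> odds_power \<alpha> \<beta> \<theta> w"
  using odds_power_mono[of 0 w] by (simp add: odds_power_def)

lemma odds_power_convex:
  assumes "1 \<le> \<theta>" "0 \<le> t" "t \<le> 1" "0 \<le> v" "0 \<le> w"
  shows "odds_power \<alpha> \<beta> \<theta> ((1 - t) * v + t * w)
    \<le> (1 - t) * odds_power \<alpha> \<beta> \<theta> v + t * odds_power \<alpha> \<beta> \<theta> w"
proof -
  have "((1 - t) * (\<alpha> + v) + t * (\<alpha> + w)) powr \<theta>
      \<le> (1 - t) * (\<alpha> + v) powr \<theta> + t * (\<alpha> + w) powr \<theta>"
    using assms \<alpha> by (intro convex_comb_powr) auto
  moreover have "(1 - t) * (\<alpha> + v) + t * (\<alpha> + w) = \<alpha> + ((1 - t) * v + t * w)"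
    by (simp add: algebra_simps)
  ultimately have "odds_power \<alpha> \<beta> \<theta> ((1 - t) * v + t * w)
      \<le> \<beta> * ((1 - t) * (\<alpha> + v) powr \<theta> + t * (\<alpha> + w) powr \<theta> - \<alpha> powr \<theta>)"
    using \<beta> by (simp add: odds_power_def)
  also have "\<dots> = (1 - t) * odds_power \<alpha> \<beta> \<theta> v + t * odds_power \<alpha> \<beta> \<theta> w"
    by (simp add: odds_power_def algebra_simps)
  finally show ?thesis .
qed

lemma odds_power_concave:
  assumes "\<theta> \<le> 1" "0 \<le> t" "t \<le> 1" "0 \<le> v" "0 \<le> w"
  shows "(1 - t) * odds_power \<alpha> \<beta> \<theta> v + t * odds_power \<alpha> \<beta> \<theta> w
    \<le> odds_power \<alpha> \<beta> \<theta> ((1 - t) * v + t * w)"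
proof -
  have "(1 - t) * (\<alpha> + v) powr \<theta> + t * (\<alpha> + w) powr \<theta>
      \<le> ((1 - t) * (\<alpha> + v) + t * (\<alpha> + w)) powr \<theta>"
    using assms \<alpha> \<theta> by (intro concave_comb_powr) auto
  moreover have "(1 - t) * (\<alpha> + v) + t * (\<alpha> + w) = \<alpha> + ((1 - t) * v + t * w)"
    by (simp add: algebra_simps)
  ultimately have "\<beta> * ((1 - t) * (\<alpha> + v) powr \<theta> + t * (\<alpha> + w) powr \<theta> - \<alpha> powr \<theta>)
      \<le> odds_power \<alpha> \<beta> \<theta> ((1 - t) * v + t * w)"
    using \<beta> by (simp add: odds_power_def)
  moreover have "\<beta> * ((1 - t) * (\<alpha> + v) powr \<theta> + t * (\<alpha> + w) powr \<theta> - \<alpha> powr \<theta>)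
      = (1 - t) * odds_power \<alpha> \<beta> \<theta> v + t * odds_power \<alpha> \<beta> \<theta> w"
    by (simp add: odds_power_def algebra_simps)
  ultimately show ?thesis by simp
qed

lemma odds_root_strict_mono:
  "0 \<le> x \<Longrightarrow> x < y \<Longrightarrow> odds_root \<alpha> \<beta> \<theta> x < odds_root \<alpha> \<beta> \<theta> y"
  using \<beta> \<theta> by (simp add: odds_root_def powr_less_mono2 divide_strict_right_mono)

lemma odds_root_0: "odds_root \<alpha> \<beta> \<theta> 0 = 0"
  using \<alpha> \<theta> by (simp add: odds_root_def powr_powr)

lemma odds_root_nonneg: "0 \<le> x \<Longrightarrow> 0 \<le> odds_root \<alpha> \<beta> \<theta> x"
  using odds_root_strict_mono[of 0 x] by (cases "x = 0") (auto simp: odds_root_0)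

text \<open>The exponent \<open>1 / \<theta>\<close> is at least 1 and the base is affine in
  \<open>x\<close>.\<close>

lemma odds_root_convex:
  assumes "\<theta> \<le> 1" "0 \<le> t" "t \<le> 1" "0 \<le> x" "0 \<le> y"
  shows "odds_root \<alpha> \<beta> \<theta> ((1 - t) * x + t * y)
    \<le> (1 - t) * odds_root \<alpha> \<beta> \<theta> x + t * odds_root \<alpha> \<beta> \<theta> y"
proof -
  define a where "a = \<alpha> powr \<theta>"
  have "((1 - t) * (x / \<beta> + a) + t * (y / \<beta> + a)) powr (1 / \<theta>)
      \<le> (1 - t) * (x / \<beta> + a) powr (1 / \<theta>) + t * (y / \<beta> + a) powr (1 / \<theta>)"
    using assms \<beta> \<theta> by (intro convex_comb_powr) (auto simp: a_def)
  moreover have "(1 - t) * (x / \<beta> + a) + t * (y / \<beta> + a) = ((1 - t) * x + t * y) / \<beta> + a"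
    using \<beta> by (simp add: field_simps)
  ultimately show ?thesis
    unfolding odds_root_def a_def[symmetric] by (simp add: algebra_simps)
qed

text \<open>Order form of the inverse relation, suited to quantiles defined as infima:
  \<open>odds_power\<close> is strictly increasing and sends
  \<open>odds_root \<alpha> \<beta> \<theta> x\<close> to \<open>x\<close>.\<close>

lemma le_odds_root_iff:
  assumes "0 \<le> w" "0 \<le> x"
  shows "w \<le> odds_root \<alpha> \<beta> \<theta> x \<longleftrightarrow> odds_power \<alpha> \<beta> \<theta> w \<le> x"
proof -
  have inv: "odds_power \<alpha> \<beta> \<theta> (odds_root \<alpha> \<beta> \<theta> x) = x"
    using assms \<alpha> \<beta> \<theta> by (simp add: odds_power_def odds_root_def powr_powr)
  show ?thesis
    using odds_power_le_iff[OF assms(1) odds_root_nonneg[OF assms(2)]] unfolding inv by simp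
qed

section \<open>The distribution function \<open>K_df\<close> and its quantiles\<close>

lemma K_df_eq: "0 \<le> x \<Longrightarrow> K_df \<alpha> \<beta> \<theta> x = 1 - 1 / (1 + odds_root \<alpha> \<beta> \<theta> x)"
  by (simp add: K_df_def odds_root_def algebra_simps)

lemma K_df_lt_1: "K_df \<alpha> \<beta> \<theta> x < 1"
proof (cases "0 \<le> x")
  case True
  then show ?thesis using odds_root_nonneg[OF True] by (simp add: K_df_eq)
qed (simp add: K_df_def)

lemma K_df_odds: "0 \<le> x \<Longrightarrow> K_df \<alpha> \<beta> \<theta> x / (1 - K_df \<alpha> \<beta> \<theta> x) = odds_root \<alpha> \<beta> \<theta> x"
  using odds_root_nonneg[of x] by (simp add: K_df_eq field_simps)

lemma K_df_0: "x \<le> 0 \<Longrightarrow> K_df \<alpha> \<beta> \<theta> x = 0"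
  using K_df_eq[of 0] by (cases "x = 0") (auto simp: odds_root_0 K_df_def)

lemma K_df_strict_mono:
  assumes "0 \<le> x" "x < y"
  shows "K_df \<alpha> \<beta> \<theta> x < K_df \<alpha> \<beta> \<theta> y"
  using odds_root_strict_mono[OF assms] odds_root_nonneg[OF assms(1)] assms
  by (simp add: K_df_eq frac_less2)

lemma K_df_support: "df_support (K_df \<alpha> \<beta> \<theta>) = {0..}"
proof (intro set_eqI iffI)
  fix x assume x: "x \<in> {0::real..}"
  have "K_df \<alpha> \<beta> \<theta> (x - e) < K_df \<alpha> \<beta> \<theta> (x + e)" if "e > 0" for e
  proof (cases "x - e \<le> 0")
    case True
    then show ?thesis
      using K_df_strict_mono[of 0 "x + e"] x that by (simp add: K_df_0)
  next
    case False
    then show ?thesis using that by (intro K_df_strict_mono) auto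
  qed
  then show "x \<in> df_support (K_df \<alpha> \<beta> \<theta>)" by (simp add: df_support_def)
next
  fix x assume x: "x \<in> df_support (K_df \<alpha> \<beta> \<theta>)"
  show "x \<in> {0..}"
  proof (rule ccontr)
    assume "x \<notin> {0..}"
    then have "0 < - x" by simp
    \<comment> \<open>With radius \<open>- x\<close> the window around \<open>x\<close> ends at 0,
      up to which \<open>K_df\<close> vanishes.\<close>
    with x have "K_df \<alpha> \<beta> \<theta> (x - - x) < K_df \<alpha> \<beta> \<theta> (x + - x)"
      unfolding df_support_def by blast
    with \<open>0 < - x\<close> show False by (simp add: K_df_0)
  qed
qed

text \<open>Comparing odds instead of probabilities turns the set in the infimum into a closed
  half-line, whose end point is the quantile.\<close>

lemma df_inverse_K_df:
  assumes "0 \<le> p" "p < 1"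
  shows "df_inverse (K_df \<alpha> \<beta> \<theta>) p = ereal (odds_power \<alpha> \<beta> \<theta> (p / (1 - p)))"
proof -
  let ?q = "odds_power \<alpha> \<beta> \<theta> (p / (1 - p))"
  have p: "0 \<le> p / (1 - p)" using assms by simp
  have "p \<le> K_df \<alpha> \<beta> \<theta> x \<longleftrightarrow> ?q \<le> x" if "0 \<le> x" for x
    using real_odds_le_iff[OF assms(2) K_df_lt_1[of x]] that
    by (simp only: K_df_odds le_odds_root_iff[OF p])
  then have "{x \<in> {0..}. p \<le> K_df \<alpha> \<beta> \<theta> x} = {?q..}"
    using odds_power_nonneg[OF p] by auto
  then show ?thesis
    unfolding df_inverse_def K_df_support by (auto intro!: antisym Inf_lower Inf_greatest)
qed

text \<open>\<open>K_df\<close> stays below 1, so the infimum runs over the empty set.\<close>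

lemma df_inverse_K_df_1: "df_inverse (K_df \<alpha> \<beta> \<theta>) 1 = \<infinity>"
  using K_df_lt_1 by (simp add: df_inverse_def not_le[symmetric] top_ereal_def)

end

text \<open>Combinations of near-minimisers over \<open>A\<close> and \<open>B\<close> compete in
  the infimum over \<open>C\<close>. The common bound \<open>m\<close> keeps the infima over
  nonempty sets finite.\<close>

lemma Inf_ereal_convex_comb:
  fixes A B C :: "real set"
  assumes "0 < t" "t < 1" "\<And>a. a \<in> A \<Longrightarrow> m \<le> a" "\<And>b. b \<in> B \<Longrightarrow> m \<le> b"
    and comb: "\<And>a b. a \<in> A \<Longrightarrow> b \<in> B \<Longrightarrow> (1 - t) * a + t * b \<in> C"
  shows "Inf (ereal ` C) \<le> ereal (1 - t) * Inf (ereal ` A) + ereal t * Inf (ereal ` B)"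
proof (cases "A = {} \<or> B = {}")
  case True
  with assms show ?thesis by (auto simp: top_ereal_def)
next
  case False
  have bdd: "bdd_below A" "bdd_below B" using assms by (auto simp: bdd_below_def)
  have "Inf (ereal ` C) \<le> ereal ((1 - t) * Inf A + t * Inf B) + ereal e" if e: "0 < e" for e
  proof -
    obtain a b where ab: "a \<in> A" "a < Inf A + e" "b \<in> B" "b < Inf B + e"
      using False e cInf_lessD[of A "Inf A + e"] cInf_lessD[of B "Inf B + e"] by auto
    have "Inf (ereal ` C) \<le> ereal ((1 - t) * a + t * b)"
      using comb ab by (intro Inf_lower) auto
    also have "(1 - t) * a + t * b \<le> (1 - t) * (Inf A + e) + t * (Inf B + e)"
      using ab assms by (intro add_mono mult_left_mono) auto
    also have "\<dots> = (1 - t) * Inf A + t * Inf B + e" by (simp add: algebra_simps)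
    finally show ?thesis by simp
  qed
  then have "Inf (ereal ` C) \<le> ereal ((1 - t) * Inf A + t * Inf B)"
    using ereal_le_epsilon2 by blast
  then show ?thesis
    using False bdd by (simp flip: ereal_Inf')
qed

section \<open>Convex transform order\<close>

locale odds_transform = df_with_density +
  fixes G :: "real \<Rightarrow> real" and \<alpha> \<beta> \<theta> :: real
  assumes \<alpha>: "0 \<le> \<alpha>" and \<beta>: "0 < \<beta>" and \<theta>: "0 < \<theta>"
    and df_G: "distribution_function G"
    and odds_G: "odds G x = ereal \<beta> * (epowr (ereal \<alpha> + odds F x) \<theta> - ereal (\<alpha> powr \<theta>))"
begin

section \<open>Odds, order and support of \<open>G\<close>\<close>

lemma odds_G_finite:
  assumes "F x < 1"
  shows "odds G x = ereal (odds_power \<alpha> \<beta> \<theta> (L x))"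
  using assms by (simp add: odds_G odds_def[of F] epowr_def odds_power_def)

lemma G_bounds: "0 \<le> G x" "G x \<le> 1"
proof -
  obtain M where "real_distribution M" and GM: "G = cdf M"
    using df_G by (auto simp: distribution_function_def)
  then interpret real_distribution M by simp
  show "0 \<le> G x" "G x \<le> 1" by (simp_all add: GM cdf_nonneg cdf_bounded_prob)
qed

text \<open>Infinite odds survive \<open>epowr\<close> and the factor \<open>\<beta> > 0\<close>,
  while finite odds stay finite.\<close>

lemma G_eq_1_iff: "G x = 1 \<longleftrightarrow> F x = 1"
proof (cases "F x = 1")
  case True
  then have "odds G x = \<infinity>" using \<beta> by (simp add: odds_G odds_def[of F] epowr_def)
  with True show ?thesis by (auto simp: odds_def split: if_splits)
next
  case False
  then have "F x < 1" using F_le_1[of x] by simp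
  from odds_G_finite[OF this] False show ?thesis by (auto simp: odds_def)
qed

lemma G_lt_1_iff: "G x < 1 \<longleftrightarrow> F x < 1"
  using G_eq_1_iff[of x] F_le_1[of x] G_bounds[of x] by linarith

lemma G_odds: "F x < 1 \<Longrightarrow> G x / (1 - G x) = odds_power \<alpha> \<beta> \<theta> (L x)"
  using odds_G_finite[of x] G_lt_1_iff[of x] by (simp add: odds_def)

text \<open>\<open>odds_power\<close> is strictly increasing on odds, so \<open>G\<close> is a
  strictly increasing function of \<open>F\<close>. This is what makes the two supports
  agree.\<close>

lemma G_less_iff: "G x < G y \<longleftrightarrow> F x < F y"
proof (cases "F x < 1 \<and> F y < 1")
  case True
  then have "G y \<le> G x \<longleftrightarrow> odds_power \<alpha> \<beta> \<theta> (L y) \<le> odds_power \<alpha> \<beta> \<theta> (L x)"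
    using real_odds_le_iff[of "G y" "G x"] by (simp add: G_odds G_lt_1_iff)
  also have "\<dots> \<longleftrightarrow> F y \<le> F x"
    using True real_odds_le_iff[of "F y" "F x"]
    by (simp only: odds_power_le_iff[OF \<alpha> \<beta> \<theta> L_nonneg L_nonneg])
  finally show ?thesis by linarith
next
  case False
  then show ?thesis
    using G_lt_1_iff[of x] G_lt_1_iff[of y] F_le_1[of x] F_le_1[of y] G_bounds[of x] G_bounds[of y]
    by linarith
qed

lemma G_support: "df_support G = df_support F"
  by (simp add: df_support_def G_less_iff)

theorem increasing_le_K_df:
  assumes incr: "increasing_odds_rate F f" and "1 \<le> \<theta>"
    and K: "0 \<le> \<alpha>\<^sub>1" "0 < \<beta>\<^sub>1" "0 < \<theta>\<^sub>1" "1 \<le> \<theta>\<^sub>1"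
  shows "G \<le>\<^sub>c K_df \<alpha>\<^sub>1 \<beta>\<^sub>1 \<theta>\<^sub>1"
proof -
  let ?g = "odds_power \<alpha> \<beta> \<theta>" and ?k = "odds_power \<alpha>\<^sub>1 \<beta>\<^sub>1 \<theta>\<^sub>1"
  define \<phi> where "\<phi> x = df_inverse (K_df \<alpha>\<^sub>1 \<beta>\<^sub>1 \<theta>\<^sub>1) (G x)" for x
  note g_nonneg = odds_power_nonneg[OF \<alpha> \<beta> \<theta>]
  have fin: "\<phi> x = ereal (?k (?g (L x)))" if "F x < 1" for x
    using that G_bounds[of x] df_inverse_K_df[OF K(1-3), of "G x"]
    by (simp add: \<phi>_def G_odds G_lt_1_iff)
  have inf: "\<phi> x = \<infinity>" if "\<not> F x < 1" for x
  proof -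
    have "G x = 1" using that F_le_1[of x] G_eq_1_iff[of x] by simp
    then show ?thesis by (simp add: \<phi>_def df_inverse_K_df_1[OF K(1-3)])
  qed
  have "\<phi> ((1 - t) * x + t * y) \<le> ereal (1 - t) * \<phi> x + ereal t * \<phi> y"
    if S: "x \<in> df_support F" "y \<in> df_support F" and t: "0 < t" "t < 1" for x y t
  proof (cases "F x < 1 \<and> F y < 1")
    \<comment> \<open>A point with \<open>F = 1\<close> contributes \<open>\<infinity>\<close> with
      positive weight, so the right-hand side is infinite.\<close>
    case False
    then have "ereal (1 - t) * \<phi> x + ereal t * \<phi> y = \<infinity>"
      using t inf by auto
    then show ?thesis by (simp only: ereal_less_eq)
  next
    case True
    let ?z = "(1 - t) * x + t * y"
    have "?z \<le> max x y" using convex_bound_le[of x "max x y" y "1 - t" t] t by simp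
    then have z: "F ?z < 1" using F_mono[of ?z "max x y"] True by (auto simp: max_def split: if_splits)
    \<comment> \<open>Monotonicity of the outer map, then its convexity, first for \<open>?g\<close>
      after \<open>L\<close> and then for \<open>?k\<close>.\<close>
    have "?g (L ?z) \<le> ?g ((1 - t) * L x + t * L y)"
      using True S t by (intro odds_power_mono[OF \<alpha> \<beta> \<theta>] L_convex incr L_nonneg) auto
    also have "\<dots> \<le> (1 - t) * ?g (L x) + t * ?g (L y)"
      using t assms by (intro odds_power_convex[OF \<alpha> \<beta> \<theta>] L_nonneg) auto
    finally have "?k (?g (L ?z)) \<le> ?k ((1 - t) * ?g (L x) + t * ?g (L y))"
      by (intro odds_power_mono[OF K(1-3)] g_nonneg L_nonneg)
    also have "\<dots> \<le> (1 - t) * ?k (?g (L x)) + t * ?k (?g (L y))"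
      using t by (intro odds_power_convex[OF K] g_nonneg L_nonneg) auto
    finally show ?thesis using True z by (simp add: fin)
  qed
  then show ?thesis
    using is_interval_convex[OF interval_support]
    unfolding convex_transform_le_def ereal_convex_on_def G_support \<phi>_def by blast
qed

theorem decreasing_K_df_le:
  assumes decr: "decreasing_odds_rate F f" and "\<theta> \<le> 1"
    and K: "0 \<le> \<alpha>\<^sub>1" "0 < \<beta>\<^sub>1" "0 < \<theta>\<^sub>1" "\<theta>\<^sub>1 \<le> 1"
  shows "K_df \<alpha>\<^sub>1 \<beta>\<^sub>1 \<theta>\<^sub>1 \<le>\<^sub>c G"
proof -
  let ?g = "odds_power \<alpha> \<beta> \<theta>" and ?u = "odds_root \<alpha>\<^sub>1 \<beta>\<^sub>1 \<theta>\<^sub>1" and ?K = "K_df \<alpha>\<^sub>1 \<beta>\<^sub>1 \<theta>\<^sub>1"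
  \<comment> \<open>The infimum of \<open>A x\<close> is the quantile of \<open>G\<close> at
    \<open>?K x\<close>, since \<open>G\<close> and \<open>F\<close> have the same support.\<close>
  define A where "A x = {s \<in> df_support F. ?K x \<le> G s}" for x
  obtain m where m: "\<And>s. s \<in> df_support F \<Longrightarrow> m \<le> s"
    using decreasing_support_bdd_below[OF decr] by blast
  \<comment> \<open>On the support \<open>F < 1\<close>, so membership can be expressed through
    finite odds.\<close>
  have A_iff: "s \<in> A x \<longleftrightarrow> s \<in> df_support F \<and> ?u x \<le> ?g (L s)" if "0 \<le> x" for s x
  proof (cases "s \<in> df_support F")
    case True
    then have "F s < 1" by (rule decreasing_F_lt_1[OF decr])
    then show ?thesis
      using real_odds_le_iff[OF K_df_lt_1[OF K(1-3), of x], of "G s"] that True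
      by (simp only: A_def G_odds K_df_odds[OF K(1-3)] G_lt_1_iff) simp
  qed (simp add: A_def)
  \<comment> \<open>The pairs \<open>(x, s)\<close> with \<open>s \<in> A x\<close> form a convex
    set: a convex function of \<open>x\<close> is bounded by a concave function of
    \<open>s\<close>.\<close>
  have comb: "(1 - t) * a + t * b \<in> A ((1 - t) * x + t * y)"
    if xy: "0 \<le> x" "0 \<le> y" and t: "0 < t" "t < 1" and ab: "a \<in> A x" "b \<in> A y" for x y t a b
  proof -
    have a: "a \<in> df_support F" "?u x \<le> ?g (L a)" and b: "b \<in> df_support F" "?u y \<le> ?g (L b)"
      using ab xy A_iff by auto
    have "?u ((1 - t) * x + t * y) \<le> (1 - t) * ?u x + t * ?u y"
      using t xy by (intro odds_root_convex[OF K]) auto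
    also have "\<dots> \<le> (1 - t) * ?g (L a) + t * ?g (L b)"
      using t a b by (intro add_mono mult_left_mono) auto
    also have "\<dots> \<le> ?g ((1 - t) * L a + t * L b)"
      using t assms by (intro odds_power_concave[OF \<alpha> \<beta> \<theta>] L_nonneg) auto
    also have "\<dots> \<le> ?g (L ((1 - t) * a + t * b))"
      using t a b decreasing_F_lt_1[OF decr]
      by (intro odds_power_mono[OF \<alpha> \<beta> \<theta>] L_concave decr add_nonneg_nonneg mult_nonneg_nonneg L_nonneg)
        auto
    finally have "?u ((1 - t) * x + t * y) \<le> ?g (L ((1 - t) * a + t * b))" .
    moreover have "(1 - t) * a + t * b \<in> df_support F"
      using convexD[OF is_interval_convex[OF interval_support] a(1) b(1), of "1 - t" t] t by simp
    ultimately show ?thesis using xy t by (subst A_iff) auto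
  qed
  have "Inf (ereal ` A ((1 - t) * x + t * y))
      \<le> ereal (1 - t) * Inf (ereal ` A x) + ereal t * Inf (ereal ` A y)"
    if "0 \<le> x" "0 \<le> y" "0 < t" "t < 1" for x y t
    using that comb m by (intro Inf_ereal_convex_comb[where m = m]) (auto simp: A_def)
  then show ?thesis
    unfolding convex_transform_le_def ereal_convex_on_def K_df_support[OF K(1-3)] df_inverse_def
      G_support A_def by simp
qed

end

theorem theorem5p14:
  fixes F f G :: "real \<Rightarrow> real"
    and \<alpha> \<beta> \<theta> \<alpha>\<^sub>1 \<beta>\<^sub>1 \<theta>\<^sub>1 :: real
  assumes "distribution_function F"
    and "has_density F f"
    and "is_interval (df_support F)"
    and "0 \<le> \<alpha>" and "0 < \<beta>" and "0 < \<theta>"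
    and "0 \<le> \<alpha>\<^sub>1" and "0 < \<beta>\<^sub>1" and "0 < \<theta>\<^sub>1"
    and "distribution_function G"
    and "\<And>x. odds G x =
           ereal \<beta> * (epowr (ereal \<alpha> + odds F x) \<theta> - ereal (\<alpha> powr \<theta>))"
  shows "(increasing_odds_rate F f \<and> 1 \<le> \<theta> \<and> 1 \<le> \<theta>\<^sub>1 \<longrightarrow> G \<le>\<^sub>c K_df \<alpha>\<^sub>1 \<beta>\<^sub>1 \<theta>\<^sub>1) \<and>
         (decreasing_odds_rate F f \<and> \<theta> \<le> 1 \<and> \<theta>\<^sub>1 \<le> 1 \<longrightarrow> K_df \<alpha>\<^sub>1 \<beta>\<^sub>1 \<theta>\<^sub>1 \<le>\<^sub>c G)"
proof -
  interpret odds_transform F f G \<alpha> \<beta> \<theta>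
    by unfold_locales (fact assms)+
  show ?thesis
    using assms(7-9) increasing_le_K_df decreasing_K_df_le by blast
qed

end
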